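(* Let $q$ be a power of $2$ with $q\ge 4$, and let $\mathcal{D}(q)$ be a quasi-symmetric design of Blokhuis-Haemers type. Then the binary linear code spanned by the rows of a point-by-block incidence matrix of $\mathcal{D}(q)$ is self-orthogonal. If $q\ge 8$, this code is doubly even.
   Context: A $2$-$(v,k,\lambda)$ design is a finite incidence structure $(\mathcal{P},\mathcal{B},\mathcal{I})$ with $v$ points, each block incident with exactly $k$ points, and any two distinct points incident with exactly $\lambda$ common blocks; it is symmetric if the number of blocks equals $v$. For $0\le s<k$, $s$ is a block intersection number if there are two blocks with exactly $s$ common points; the design is quasi-symmetric if it has exactly two block intersection numbers $x<y$. Designs of Blokhuis-Haemers type: let $q$ be a power of $2$. Let $\mathcal{D}_1$ be a symmetric $2$-$(q^2,q(q-1)/2,q(q-2)/4)$ design whose blocks are maximal arcs in the affine plane $AG(2,q)$ (sets of $q(q-1)/2$ points meeting every line in $0$ or $q/2$ points), and let $\mathcal{D}_2$ be the resolvable $2$-$(q^3,q,1)$ design of points and lines of $AG(3,q)$. For every parallel class $P$ of $q^2$ lines of $AG(3,q)$, label the lines in $P$ by the points of $\mathcal{D}_1$, and for each block $B$ of $\mathcal{D}_1$ define a block of the new design as the union of the $q(q-1)/2$ lines of $P$ labelled by the points of $B$; here the labelling is such that the sets of lines labelled by blocks of $\mathcal{D}_1$ are maximal arcs in the quotient affine plane $AG(2,q)$ whose points are the lines of $P$ (and whose lines are given by the planes of $AG(3,q)$ that are unions of lines of $P$). The points of the new design are the points of $AG(3,q)$, and its blocks are all the blocks obtained in this way from all parallel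 classes. The resulting design $\mathcal{D}(q)$ is called a design of Blokhuis-Haemers type. It is known (Blokhuis and Haemers) that $\mathcal{D}(q)$ is a quasi-symmetric $2$-$(q^3,\,q^2(q-1)/2,\,q(q^3-q^2-2)/4)$ design with block intersection numbers $x=q^2(q-2)/4$ and $y=q^2(q-1)/4$. The point-by-block incidence matrix is the $0/1$ matrix with rows indexed by points and columns by blocks, with entry $1$ exactly when the point is incident with the block; entries are read in $\mathbb{F}_2$. A binary code is doubly even if all codewords have weight divisible by $4$, and self-orthogonal if $C\subseteq C^\perp$ for the standard inner product. *)

theory Defs
  imports "HOL-Analysis.Analysis" "HOL-Library.Z2" "HOL-Library.Function_Algebras"
begin

section \<open>Incidence structures and designs\<close>

text \<open>The value of \<open>incident\<close> outside \<open>points \<times> blocks\<close> is never used.\<close>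

record ('p, 'b) incidence_structure =
  points :: "'p set"
  blocks :: "'b set"
  incident :: "'p \<Rightarrow> 'b \<Rightarrow> bool"

definition block_points :: "('p, 'b) incidence_structure \<Rightarrow> 'b \<Rightarrow> 'p set" where
  "block_points D b = {p \<in> points D. incident D p b}"

definition two_design :: "('p, 'b) incidence_structure \<Rightarrow> nat \<Rightarrow> nat \<Rightarrow> nat \<Rightarrow> bool" where
  "two_design D v k lam \<longleftrightarrow>
     finite (points D) \<and> finite (blocks D) \<and> card (points D) = v \<and>
     (\<forall>b\<in>blocks D. card (block_points D b) = k) \<and>
     (\<forall>p\<in>points D. \<forall>p'\<in>points D. p \<noteq> p' \<longrightarrow>
        card {b \<in> blocks D. incident D p b \<and> incident D p' b} = lam)"

definition symmetric_two_design :: "('p, 'b) incidence_structure \<Rightarrow> nat \<Rightarrow> nat \<Rightarrow> nat \<Rightarrow> bool" where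
  "symmetric_two_design D v k lam \<longleftrightarrow> two_design D v k lam \<and> card (blocks D) = v"

definition block_intersection_number :: "('p, 'b) incidence_structure \<Rightarrow> nat \<Rightarrow> nat \<Rightarrow> bool" where
  "block_intersection_number D k s \<longleftrightarrow> s < k \<and>
     (\<exists>b\<in>blocks D. \<exists>c\<in>blocks D. b \<noteq> c \<and> card (block_points D b \<inter> block_points D c) = s)"

definition quasi_symmetric :: "('p, 'b) incidence_structure \<Rightarrow> bool" where
  "quasi_symmetric D \<longleftrightarrow>
     (\<exists>v k lam. two_design D v k lam \<and>
        (\<exists>x y. x < y \<and> {s. block_intersection_number D k s} = {x, y}))"


section \<open>Affine geometry over a finite field\<close>

text \<open>The points of \<open>AG(n,q)\<close> are the vectors of \<open>'a ^ 'n\<close>, where \<open>'a\<close> is the field with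
  \<open>q = CARD('a)\<close> elements and \<open>CARD('n) = n\<close>.\<close>

definition affine_flat :: "nat \<Rightarrow> ('a::field ^ 'n) set \<Rightarrow> bool" where
  "affine_flat m S \<longleftrightarrow> (\<exists>a U. vec.subspace U \<and> vec.dim U = m \<and> S = (\<lambda>u. a + u) ` U)"

definition ag_lines :: "('a::field ^ 'n) set set" where
  "ag_lines = {l. affine_flat 1 l}"

definition ag_planes :: "('a::field ^ 'n) set set" where
  "ag_planes = {\<pi>. affine_flat 2 \<pi>}"

definition parallel_classes :: "('a::field ^ 'n) set set set" where
  "parallel_classes = {{(\<lambda>u. a + u) ` U | a. True} | U. vec.subspace U \<and> vec.dim U = 1}"

definition quotient_lines :: "('a::field ^ 'n) set set \<Rightarrow> ('a ^ 'n) set set set" where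
  "quotient_lines P =
     {{l \<in> P. l \<subseteq> \<pi>} | \<pi>. \<pi> \<in> ag_planes \<and> \<Union>{l \<in> P. l \<subseteq> \<pi>} = \<pi>}"

text \<open>Stated for an arbitrary affine plane of order \<open>q\<close>, given by its set of lines, because it is
  used both for \<open>AG(2,q)\<close> and for the quotient planes of \<open>AG(3,q)\<close>. The divisions are exact
  for even \<open>q\<close>.\<close>

definition maximal_arc :: "nat \<Rightarrow> 'p set set \<Rightarrow> 'p set \<Rightarrow> bool" where
  "maximal_arc q Ls S \<longleftrightarrow>
     card S = q * (q - 1) div 2 \<and> (\<forall>l\<in>Ls. card (S \<inter> l) = 0 \<or> card (S \<inter> l) = q div 2)"


section \<open>Designs of Blokhuis--Haemers type\<close>

text \<open>The map \<open>lab P\<close> sends a point of \<open>D1\<close> to the line of the parallel class \<open>P\<close> labelled by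
  it. The division by 4 is exact for \<open>q\<close> a power of 2.\<close>

definition blokhuis_haemers_data ::
  "('a::{field,finite} ^ 2, 'b) incidence_structure \<Rightarrow>
   (('a ^ 3) set set \<Rightarrow> 'a ^ 2 \<Rightarrow> ('a ^ 3) set) \<Rightarrow> bool" where
  "blokhuis_haemers_data D1 lab \<longleftrightarrow>
     (let q = CARD('a) in
        points D1 = UNIV \<and>
        symmetric_two_design D1 (q ^ 2) (q * (q - 1) div 2) (q * (q - 2) div 4) \<and>
        (\<forall>b\<in>blocks D1. maximal_arc q ag_lines (block_points D1 b)) \<and>
        (\<forall>P\<in>parallel_classes.
           bij_betw (lab P) (points D1) P \<and>
           (\<forall>b\<in>blocks D1. maximal_arc q (quotient_lines P) (lab P ` block_points D1 b))))"

definition blokhuis_haemers_design ::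
  "('a::{field,finite} ^ 2, 'b) incidence_structure \<Rightarrow>
   (('a ^ 3) set set \<Rightarrow> 'a ^ 2 \<Rightarrow> ('a ^ 3) set) \<Rightarrow>
   ('a ^ 3, ('a ^ 3) set) incidence_structure" where
  "blokhuis_haemers_design D1 lab =
     \<lparr>points = UNIV,
      blocks = {\<Union>(lab P ` block_points D1 b) | P b. P \<in> parallel_classes \<and> b \<in> blocks D1},
      incident = (\<lambda>p B. p \<in> B)\<rparr>"


section \<open>Binary codes\<close>

text \<open>A binary word whose coordinate positions form the finite set \<open>X\<close> is a function to the field
  \<open>bit\<close> that vanishes outside \<open>X\<close>.\<close>

definition scale_word :: "bit \<Rightarrow> ('b \<Rightarrow> bit) \<Rightarrow> 'b \<Rightarrow> bit" where
  "scale_word c w = (\<lambda>i. c * w i)"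

global_interpretation word: vector_space "scale_word :: bit \<Rightarrow> ('b \<Rightarrow> bit) \<Rightarrow> 'b \<Rightarrow> bit"
  by unfold_locales (auto simp: scale_word_def fun_eq_iff algebra_simps)

definition hamming_weight :: "'b set \<Rightarrow> ('b \<Rightarrow> bit) \<Rightarrow> nat" where
  "hamming_weight X w = card {i \<in> X. w i \<noteq> 0}"

definition dual_code :: "'b set \<Rightarrow> ('b \<Rightarrow> bit) set \<Rightarrow> ('b \<Rightarrow> bit) set" where
  "dual_code X C = {u. (\<forall>i. i \<notin> X \<longrightarrow> u i = 0) \<and> (\<forall>w\<in>C. (\<Sum>i\<in>X. u i * w i) = 0)}"

definition self_orthogonal :: "'b set \<Rightarrow> ('b \<Rightarrow> bit) set \<Rightarrow> bool" where
  "self_orthogonal X C \<longleftrightarrow> C \<subseteq> dual_code X C"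

definition doubly_even :: "'b set \<Rightarrow> ('b \<Rightarrow> bit) set \<Rightarrow> bool" where
  "doubly_even X C \<longleftrightarrow> (\<forall>w\<in>C. 4 dvd hamming_weight X w)"

definition incidence_matrix :: "('p, 'b) incidence_structure \<Rightarrow> 'p \<Rightarrow> 'b \<Rightarrow> bit" where
  "incidence_matrix D p b =
     (if p \<in> points D \<and> b \<in> blocks D \<and> incident D p b then 1 else 0)"

definition row_code :: "('p, 'b) incidence_structure \<Rightarrow> ('b \<Rightarrow> bit) set" where
  "row_code D = word.span (incidence_matrix D ` points D)"

end

theory Submission
  imports Defs
begin

text \<open>Write \<open>k = q (q - 1) / 2\<close> and \<open>lam = q (q - 2) / 4\<close> for the parameters of the symmetric
  design \<open>D1\<close>. The weight of the row of a point \<open>x\<close>, and the number of ones that the rows of two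
  points \<open>x\<close> and \<open>y\<close> have in common, can be counted one parallel class at a time. In a class
  \<open>P\<close> the blocks through \<open>x\<close> correspond to the blocks of \<open>D1\<close> on the label of the line of \<open>P\<close>
  through \<open>x\<close>, and there are \<open>k\<close> of these because \<open>D1\<close> is symmetric. The blocks of \<open>P\<close> through
  \<open>x\<close> and \<open>y\<close> are \<open>k\<close> or \<open>lam\<close> in number, according to whether or not \<open>x\<close> and \<open>y\<close> lie on
  the same line of \<open>P\<close>. If \<open>q\<close> is a power of 2 and \<open>q \<ge> 4\<close>, then \<open>k\<close> and \<open>lam\<close> are both even,
  so the rows are pairwise orthogonal and orthogonal to themselves. If \<open>q \<ge> 8\<close>, then moreover
  \<open>4\<close> divides \<open>k\<close>, hence every row weight, and for a code spanned by pairwise orthogonal words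
  this is enough to be doubly even (\<open>doubly_even_span\<close>).

  The count presupposes that different pairs of a parallel class and a block of \<open>D1\<close> yield
  different point sets, because the blocks of the new design form a set of point sets
  (\<open>bh_block_inj\<close>). Within one class this says that blocks of \<open>D1\<close> are determined by their points:
  two distinct blocks of a symmetric design meet in \<open>lam < k\<close> points
  (\<open>symmetric_two_design_block_intersection\<close>). For two different classes it follows from
  the arc condition: a block that was a union of lines in two directions would contain a
  plane, and so its arc would contain a full line of the quotient plane
  (\<open>maximal_arc_not_translation_invariant\<close>).\<close>

section \<open>Binary codes generated by pairwise orthogonal words\<close>

lemma inner_product_bit_eq_0_iff:
  fixes u w :: "'b \<Rightarrow> bit"
  assumes "finite X"
  shows "(\<Sum>i\<in>X. u i * w i) = 0 \<longleftrightarrow> even (card {i\<in>X. u i \<noteq> 0 \<and> w i \<noteq> 0})"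
  using assms
proof (induction X rule: finite_induct)
  case empty
  then show ?case by simp
next
  case (insert x F)
  have "{i \<in> insert x F. u i \<noteq> 0 \<and> w i \<noteq> 0} =
      (if u x \<noteq> 0 \<and> w x \<noteq> 0 then insert x {i\<in>F. u i \<noteq> 0 \<and> w i \<noteq> 0}
       else {i\<in>F. u i \<noteq> 0 \<and> w i \<noteq> 0})"
    by auto
  with insert show ?case
    by (cases "u x"; cases "w x"; cases "\<Sum>i\<in>F. u i * w i") auto
qed

lemma subspace_dual_code: "word.subspace (dual_code X C)"
proof (rule word.subspaceI)
  show "0 \<in> dual_code X C"
    by (simp add: dual_code_def)
next
  fix x y assume "x \<in> dual_code X C" "y \<in> dual_code X C"
  moreover have "(\<Sum>i\<in>X. (x + y) i * w i) = (\<Sum>i\<in>X. x i * w i) + (\<Sum>i\<in>X. y i * w i)" for w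
    by (simp only: plus_fun_apply distrib_right sum.distrib)
  ultimately show "x + y \<in> dual_code X C"
    by (simp add: dual_code_def del: mult_bit_eq_and)
next
  fix c x assume "x \<in> dual_code X C"
  moreover have "(\<Sum>i\<in>X. scale_word c x i * w i) = c * (\<Sum>i\<in>X. x i * w i)" for w
    by (simp only: scale_word_def sum_distrib_left mult.assoc)
  ultimately show "scale_word c x \<in> dual_code X C"
    by (cases c) (simp_all add: dual_code_def scale_word_def)
qed

lemma dual_code_span: "dual_code X (word.span C) = dual_code X C"
proof
  show "dual_code X (word.span C) \<subseteq> dual_code X C"
    using word.span_superset[of C] by (auto simp: dual_code_def)
next
  show "dual_code X C \<subseteq> dual_code X (word.span C)"
  proof
    fix u assume u: "u \<in> dual_code X C"
    have "(\<Sum>i\<in>X. u i * w i) = 0" if "w \<in> word.span C" for w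
      using that
    proof (induction rule: word.span_induct_alt)
      case base
      then show ?case by simp
    next
      case (step c x y)
      have "(\<Sum>i\<in>X. u i * (scale_word c x + y) i) =
          c * (\<Sum>i\<in>X. u i * x i) + (\<Sum>i\<in>X. u i * y i)"
        by (simp only: scale_word_def plus_fun_apply distrib_left sum.distrib sum_distrib_left
          mult.left_commute)
      also have "\<dots> = 0"
        using u step by (simp add: dual_code_def)
      finally show ?case .
    qed
    with u show "u \<in> dual_code X (word.span C)"
      by (simp add: dual_code_def)
  qed
qed

lemma self_orthogonal_span:
  assumes "G \<subseteq> dual_code X G"
  shows "self_orthogonal X (word.span G)"
  unfolding self_orthogonal_def dual_code_span
  by (rule word.span_minimal[OF assms subspace_dual_code])

lemma hamming_weight_add:
  assumes "finite X"
  shows "hamming_weight X (u + w) + 2 * card {i\<in>X. u i \<noteq> 0 \<and> w i \<noteq> 0} =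
    hamming_weight X u + hamming_weight X w"
proof -
  let ?U = "{i\<in>X. u i \<noteq> 0}" and ?W = "{i\<in>X. w i \<noteq> 0}"
  have fin: "finite ?U" "finite ?W"
    using assms by auto
  have sum: "{i\<in>X. (u + w) i \<noteq> 0} = (?U \<union> ?W) - (?U \<inter> ?W)"
    by auto
  have both: "{i\<in>X. u i \<noteq> 0 \<and> w i \<noteq> 0} = ?U \<inter> ?W"
    by auto
  have "card ((?U \<union> ?W) - (?U \<inter> ?W)) + card (?U \<inter> ?W) = card (?U \<union> ?W)"
    using fin by (subst card_Diff_subset) (auto intro!: le_add_diff_inverse2 card_mono)
  with card_Un_Int[OF fin] show ?thesis
    unfolding hamming_weight_def sum both by simp
qed

text \<open>Two words of a self-orthogonal code have an even number of common nonzero positions, so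
  adding them changes the sum of their weights by a multiple of 4.\<close>

lemma doubly_even_span:
  assumes "finite X" and G: "G \<subseteq> dual_code X G"
    and wt: "\<And>g. g \<in> G \<Longrightarrow> 4 dvd hamming_weight X g"
  shows "doubly_even X (word.span G)"
proof -
  have "w \<in> word.span G \<and> 4 dvd hamming_weight X w" if "w \<in> word.span G" for w
    using that
  proof (induction rule: word.span_induct_alt)
    case base
    have "hamming_weight X 0 = 0"
      by (simp add: hamming_weight_def)
    then show ?case
      by (metis word.span_zero dvd_0_right)
  next
    case (step c x y)
    have span: "scale_word c x + y \<in> word.span G"
      using step by (blast intro: word.span_add word.span_scale word.span_base)
    show ?case
    proof (cases "c = 0")
      case True
      then have "scale_word c x + y = y"
        by (simp add: scale_word_def fun_eq_iff)
      with step show ?thesis by (simp only: simp_thms)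
    next
      case False
      then have c: "scale_word c x + y = x + y"
        by (simp add: scale_word_def fun_eq_iff)
      have "x \<in> dual_code X (word.span G)"
        using G step by (auto simp: dual_code_span)
      then have "(\<Sum>i\<in>X. x i * y i) = 0"
        using step by (simp add: dual_code_def)
      then have "even (card {i\<in>X. x i \<noteq> 0 \<and> y i \<noteq> 0})"
        using inner_product_bit_eq_0_iff[OF \<open>finite X\<close>] by blast
      then have "4 dvd 2 * card {i\<in>X. x i \<noteq> 0 \<and> y i \<noteq> 0}"
        by presburger
      moreover have "4 dvd hamming_weight X x + hamming_weight X y"
        using step wt by simp
      ultimately have "4 dvd hamming_weight X (x + y)"
        unfolding hamming_weight_add[OF \<open>finite X\<close>, of x y, symmetric] using dvd_add_left_iff by blast
      with c span show ?thesis by (simp only: simp_thms)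
    qed
  qed
  then show ?thesis
    by (auto simp: doubly_even_def)
qed

section \<open>Symmetric designs\<close>

lemma two_design_replication:
  assumes D: "two_design D v k lam" and p: "p \<in> points D"
  shows "card {b\<in>blocks D. incident D p b} * (k - 1) = lam * (v - 1)"
proof -
  let ?B = "{b\<in>blocks D. incident D p b}"
  have fin: "finite (points D)" "finite (blocks D)"
    using D by (auto simp: two_design_def)
  have "(\<Sum>b\<in>?B. card {p'\<in>points D - {p}. incident D p' b}) = (\<Sum>p'\<in>points D - {p}. lam)"
  proof (rule sum_multicount_gen)
    show "\<forall>p'\<in>points D - {p}. card {b\<in>?B. incident D p' b} = lam"
    proof
      fix p' assume "p' \<in> points D - {p}"
      then have "card {b\<in>blocks D. incident D p b \<and> incident D p' b} = lam"
        using D p by (auto simp: two_design_def)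
      then show "card {b\<in>?B. incident D p' b} = lam"
        by (simp add: conj_assoc)
    qed
  qed (use fin in auto)
  moreover have "card {p'\<in>points D - {p}. incident D p' b} = k - 1" if "b \<in> ?B" for b
  proof -
    have "{p'\<in>points D - {p}. incident D p' b} = block_points D b - {p}"
      by (auto simp: block_points_def)
    moreover have "p \<in> block_points D b"
      using that p by (simp add: block_points_def)
    ultimately show ?thesis
      using D that by (simp add: two_design_def)
  qed
  ultimately show ?thesis
    using D p by (simp add: two_design_def mult.commute)
qed

lemma symmetric_two_design_replication:
  assumes D: "symmetric_two_design D v k lam" and "1 < k" and p: "p \<in> points D"
  shows "card {b\<in>blocks D. incident D p b} = k"
proof -
  have D2: "two_design D v k lam" and cardB: "card (blocks D) = v"
    using D by (auto simp: symmetric_two_design_def)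
  then have fin: "finite (points D)" "finite (blocks D)" and cardP: "card (points D) = v"
    by (auto simp: two_design_def)
  let ?r = "\<lambda>x. card {b\<in>blocks D. incident D x b}"
  \<comment> \<open>Each \<open>?r x\<close> satisfies \<open>?r x * (k - 1) = lam * (v - 1)\<close>, so all are equal. As there are as many
    blocks as points, counting flags identifies the common value.\<close>
  have const: "?r x = ?r p" if "x \<in> points D" for x
    using two_design_replication[OF D2 that] two_design_replication[OF D2 p] \<open>1 < k\<close>
    by (metis mult_right_cancel zero_less_diff less_numeral_extra(3))
  have "(\<Sum>x\<in>points D. ?r x) = (\<Sum>b\<in>blocks D. k)"
    using fin D2 by (intro sum_multicount_gen) (auto simp: two_design_def block_points_def)
  then have "v * ?r p = v * k"
    using const by (simp add: cardP cardB)
  moreover have "v \<noteq> 0"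
    using p fin cardP by (auto simp: card_gt_0_iff)
  ultimately show ?thesis by simp
qed

text \<open>Fix a block \<open>c\<close> and let \<open>f b\<close> be the number of points that \<open>b\<close> shares with it. Counting
  flags and pairs of flags in \<open>c\<close> gives the first two moments of \<open>f\<close> over all blocks, and these
  yield \<open>(k - lam)\<^sup>2\<close> as the sum of \<open>(f b - lam)\<^sup>2\<close>. The term \<open>b = c\<close> accounts for all of it.\<close>

lemma symmetric_two_design_block_intersection:
  assumes D: "symmetric_two_design D v k lam" and "1 < k"
    and b: "b \<in> blocks D" and c: "c \<in> blocks D" and "b \<noteq> c"
  shows "card (block_points D b \<inter> block_points D c) = lam"
proof -
  have D2: "two_design D v k lam" and cardB: "card (blocks D) = v"
    using D by (auto simp: symmetric_two_design_def)
  then have fin: "finite (points D)" "finite (blocks D)"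
    by (auto simp: two_design_def)
  define K where "K = block_points D c"
  define f where "f b = card (block_points D b \<inter> K)" for b
  have K: "K \<subseteq> points D" "finite K" "card K = k"
    using D2 c fin by (auto simp: K_def two_design_def block_points_def)
  have f_alt: "f b = card {p\<in>K. incident D p b}" for b
    unfolding f_def using K by (intro arg_cong[where f = card]) (auto simp: block_points_def)
  have rep: "card {b\<in>blocks D. incident D p b} = k" if "p \<in> K" for p
    using symmetric_two_design_replication[OF D \<open>1 < k\<close>] that K by auto
  obtain p where p: "p \<in> K"
    using K \<open>1 < k\<close> by fastforce
  have "k * (k - 1) = lam * (v - 1)"
    using two_design_replication[OF D2, of p] rep p K by auto
  moreover have "v \<ge> 1"
    using cardB c fin by (metis card_0_eq emptyE less_one not_le)
  ultimately have param: "int k * (int k - 1) = int lam * (int v - 1)"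
    using \<open>1 < k\<close> by (metis of_nat_mult of_nat_diff of_nat_1 less_imp_le)
  have first: "(\<Sum>b\<in>blocks D. f b) = k * k"
  proof -
    have "(\<Sum>b\<in>blocks D. f b) = (\<Sum>p\<in>K. k)"
      unfolding f_alt using fin K rep by (intro sum_multicount_gen) auto
    then show ?thesis using K by simp
  qed
  have second: "(\<Sum>b\<in>blocks D. f b * f b) = k * (k + (k - 1) * lam)"
  proof -
    have "f b * f b = card {z \<in> K \<times> K. incident D (fst z) b \<and> incident D (snd z) b}" for b
    proof -
      have "{z \<in> K \<times> K. incident D (fst z) b \<and> incident D (snd z) b} =
          {p\<in>K. incident D p b} \<times> {p\<in>K. incident D p b}"
        by auto
      then show ?thesis
        by (simp add: f_alt card_cartesian_product)
    qed
    then have "(\<Sum>b\<in>blocks D. f b * f b) =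
        (\<Sum>b\<in>blocks D. card {z \<in> K \<times> K. incident D (fst z) b \<and> incident D (snd z) b})"
      by simp
    also have "\<dots> = (\<Sum>z\<in>K \<times> K. if fst z = snd z then k else lam)"
    proof (rule sum_multicount_gen)
      show "\<forall>z\<in>K \<times> K. card {b\<in>blocks D. incident D (fst z) b \<and> incident D (snd z) b} =
          (if fst z = snd z then k else lam)"
      proof
        fix z assume "z \<in> K \<times> K"
        then have z: "fst z \<in> K" "snd z \<in> K" by auto
        moreover have "card {b\<in>blocks D. incident D (fst z) b \<and> incident D (snd z) b} = lam"
          if "fst z \<noteq> snd z"
          using D2 z K that unfolding two_design_def by blast
        ultimately show "card {b\<in>blocks D. incident D (fst z) b \<and> incident D (snd z) b} =
            (if fst z = snd z then k else lam)"
          using rep by simp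
      qed
    qed (use fin K in auto)
    also have "\<dots> = (\<Sum>p\<in>K. \<Sum>p'\<in>K. if p = p' then k else lam)"
      by (simp add: sum.cartesian_product case_prod_beta)
    also have "\<dots> = (\<Sum>p\<in>K. k + (k - 1) * lam)"
    proof (rule sum.cong)
      fix p assume p: "p \<in> K"
      have "(\<Sum>p'\<in>K. if p = p' then k else lam) =
          k + (\<Sum>p'\<in>K - {p}. if p = p' then k else lam)"
        using p K by (subst sum.remove[of _ p]) auto
      also have "(\<Sum>p'\<in>K - {p}. if p = p' then k else lam) = (\<Sum>p'\<in>K - {p}. lam)"
        by (rule sum.cong) auto
      finally show "(\<Sum>p'\<in>K. if p = p' then k else lam) = k + (k - 1) * lam"
        using p K by simp
    qed simp
    finally show ?thesis using K by simp
  qed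
  have "(\<Sum>b\<in>blocks D. (int (f b) - int lam)\<^sup>2) =
      int (\<Sum>b\<in>blocks D. f b * f b) - 2 * int lam * int (\<Sum>b\<in>blocks D. f b) + int v * (int lam)\<^sup>2"
  proof -
    have "(int (f b) - int lam)\<^sup>2 =
        int (f b * f b) - 2 * int lam * int (f b) + (int lam)\<^sup>2" for b
      by (simp add: power2_eq_square algebra_simps)
    then show ?thesis
      by (simp only: sum.distrib sum_subtractf sum_distrib_left of_nat_sum sum_constant cardB)
  qed
  also have "\<dots> = int k * int k + int k * (int k - 1) * int lam - 2 * int lam * (int k * int k)
      + int v * (int lam)\<^sup>2"
  proof -
    have "int (k - 1) = int k - 1"
      using \<open>1 < k\<close> by simp
    then show ?thesis
      unfolding first second by (simp only: of_nat_mult of_nat_add) (simp add: algebra_simps)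
  qed
  also have "\<dots> = (int k - int lam)\<^sup>2"
    using param by algebra
  finally have total: "(\<Sum>b\<in>blocks D. (int (f b) - int lam)\<^sup>2) = (int k - int lam)\<^sup>2" .
  have "f c = k"
    using K by (simp add: f_def K_def)
  then have "(\<Sum>b\<in>blocks D - {c}. (int (f b) - int lam)\<^sup>2) = 0"
    using total sum.remove[OF fin(2) c, of "\<lambda>b. (int (f b) - int lam)\<^sup>2"] by simp
  then have "(int (f b) - int lam)\<^sup>2 = 0"
    using fin b \<open>b \<noteq> c\<close> by (subst (asm) sum_nonneg_eq_0_iff) auto
  then show ?thesis
    by (simp add: f_def K_def)
qed

lemma symmetric_two_design_inj_block_points:
  assumes D: "symmetric_two_design D v k lam" and "1 < k" and "lam < k"
  shows "inj_on (block_points D) (blocks D)"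
proof (rule inj_onI, rule ccontr)
  fix b c assume bc: "b \<in> blocks D" "c \<in> blocks D" "block_points D b = block_points D c" "b \<noteq> c"
  then have "card (block_points D c) = lam"
    using symmetric_two_design_block_intersection[OF D \<open>1 < k\<close>, of b c] by simp
  moreover have "card (block_points D c) = k"
    using D bc by (simp add: symmetric_two_design_def two_design_def)
  ultimately show False
    using \<open>lam < k\<close> by simp
qed

section \<open>Parallel classes and maximal arcs in their quotient planes\<close>

lemma mem_translate_iff:
  fixes a x :: "'a::field ^ 'n"
  shows "x \<in> (\<lambda>u. a + u) ` U \<longleftrightarrow> x - a \<in> U"
  by (auto simp: image_iff algebra_simps intro!: bexI[of _ "x - a"])

lemma translate_eq:
  fixes a x :: "'a::field ^ 'n"
  assumes U: "vec.subspace U" and x: "x \<in> (\<lambda>u. a + u) ` U"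
  shows "(\<lambda>u. a + u) ` U = (\<lambda>u. x + u) ` U"
proof (rule set_eqI)
  fix y
  have xa: "x - a \<in> U"
    using x by (simp add: mem_translate_iff)
  have "y - a \<in> U \<longleftrightarrow> y - x \<in> U"
    using vec.subspace_add[OF U, of "y - x" "x - a"] vec.subspace_diff[OF U, of "y - a" "x - a"] xa
    by auto
  then show "y \<in> (\<lambda>u. a + u) ` U \<longleftrightarrow> y \<in> (\<lambda>u. x + u) ` U"
    by (simp add: mem_translate_iff)
qed

lemma mem_translate_self:
  fixes a :: "'a::field ^ 'n"
  assumes "vec.subspace U"
  shows "a \<in> (\<lambda>u. a + u) ` U"
  using vec.subspace_0[OF assms] by (simp add: mem_translate_iff)

lemma parallel_class_ex1_line:
  fixes P :: "('a::field ^ 'n) set set"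
  assumes "P \<in> parallel_classes"
  shows "\<exists>!l. l \<in> P \<and> x \<in> l"
proof -
  obtain U where U: "vec.subspace U" and P: "P = {(\<lambda>u. a + u) ` U | a. True}"
    using assms by (auto simp: parallel_classes_def)
  show ?thesis
  proof (rule ex1I)
    show "(\<lambda>u. x + u) ` U \<in> P \<and> x \<in> (\<lambda>u. x + u) ` U"
      using mem_translate_self[OF U] P by auto
  next
    fix l assume "l \<in> P \<and> x \<in> l"
    with translate_eq[OF U] P show "l = (\<lambda>u. x + u) ` U"
      by blast
  qed
qed

text \<open>If the union of \<open>S\<close> admitted all translations along a second direction \<open>v\<close>, then it would
  contain a whole plane spanned by \<open>v\<close> and the direction of \<open>P\<close>. The corresponding line of
  the quotient plane would meet \<open>S\<close> in all of its \<open>q\<close> points.\<close>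

lemma maximal_arc_not_translation_invariant:
  fixes U :: "('a::{field,finite} ^ 'n) set" and v :: "'a ^ 'n"
  assumes U: "vec.subspace U" "vec.dim U = 1" and v: "v \<notin> U"
    and P: "P = {(\<lambda>u. a + u) ` U | a. True}"
    and S: "S \<subseteq> P" and arc: "maximal_arc CARD('a) (quotient_lines P) S"
    and a: "a \<in> \<Union>S"
  shows "\<exists>t. a + t *s v \<notin> \<Union>S"
proof (rule ccontr)
  assume "\<not> ?thesis"
  then have inv: "a + t *s v \<in> \<Union>S" for t by auto
  define W where "W = vec.span (insert v U)"
  define \<pi> where "\<pi> = (\<lambda>u. a + u) ` W"
  have W: "vec.subspace W"
    by (simp add: W_def vec.subspace_span)
  have UW: "U \<subseteq> W" and vW: "v \<in> W"
    unfolding W_def by (auto intro: vec.span_base)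
  have "v \<notin> vec.span U"
    using U v by (metis vec.span_eq_iff)
  with U have "vec.dim W = 2"
    by (simp add: W_def vec.dim_insert)
  then have plane: "\<pi> \<in> ag_planes"
    using W unfolding ag_planes_def affine_flat_def \<pi>_def by blast
  have line_in_plane: "(\<lambda>u. y + u) ` U \<subseteq> \<pi>" if "y \<in> \<pi>" for y
    using that UW translate_eq[OF W, of y a] unfolding \<pi>_def by blast
  define L where "L = {l\<in>P. l \<subseteq> \<pi>}"
  have "\<Union>L = \<pi>"
  proof
    show "\<pi> \<subseteq> \<Union>L"
    proof
      fix y assume "y \<in> \<pi>"
      then have "(\<lambda>u. y + u) ` U \<in> L"
        using line_in_plane unfolding L_def P by blast
      then show "y \<in> \<Union>L"
        using mem_translate_self[OF U(1)] by (rule UnionI)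
    qed
  qed (auto simp: L_def)
  with plane have "L \<in> quotient_lines P"
    unfolding quotient_lines_def L_def by auto
  with arc have small: "card (S \<inter> L) = 0 \<or> card (S \<inter> L) = CARD('a) div 2"
    by (simp add: maximal_arc_def)
  \<comment> \<open>The \<open>q\<close> parallels \<open>f t\<close> all lie in the arc and in the line \<open>L\<close> of the quotient plane.\<close>
  define f where "f t = (\<lambda>u. (a + t *s v) + u) ` U" for t
  have "f t \<in> S \<inter> L" for t
  proof
    obtain l where l: "l \<in> S" "a + t *s v \<in> l"
      using inv by auto
    then have "l = f t"
      using S translate_eq[OF U(1)] unfolding P f_def by blast
    with l show "f t \<in> S" by simp
    have "a + t *s v \<in> \<pi>"
      unfolding \<pi>_def using vW W by (auto intro: vec.subspace_scale)
    then show "f t \<in> L"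
      unfolding L_def f_def P using line_in_plane by blast
  qed
  moreover have "inj f"
  proof (rule injI, rule ccontr)
    fix s t assume st: "f s = f t" "s \<noteq> t"
    have "a + s *s v \<in> f s"
      unfolding f_def by (rule mem_translate_self[OF U(1)])
    then have "a + s *s v - (a + t *s v) \<in> U"
      unfolding st by (simp only: f_def mem_translate_iff)
    then have "(s - t) *s v \<in> U"
      by (simp add: vec.scale_left_diff_distrib)
    then have "inverse (s - t) *s ((s - t) *s v) \<in> U"
      by (rule vec.subspace_scale[OF U(1)])
    moreover have "inverse (s - t) *s ((s - t) *s v) = v"
      using st by (simp only: vec.scale_scale) simp
    ultimately show False
      using v by simp
  qed
  ultimately have "CARD('a) \<le> card (S \<inter> L)"
    by (intro card_inj_on_le) auto
  moreover have "CARD('a) > 0"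
    by simp
  ultimately show False
    using small by linarith
qed

section \<open>Designs of Blokhuis--Haemers type\<close>

definition bh_block where
  "bh_block D1 lab P b = \<Union>(lab P ` block_points D1 b)"

text \<open>The lines of \<open>P\<close> partition the space, so exactly one label belongs to a line through \<open>x\<close>.\<close>

definition label_of where
  "label_of lab P x = (THE z. x \<in> lab P z)"

lemma label_of_unique:
  fixes lab :: "('a::{field,finite} ^ 3) set set \<Rightarrow> 'a ^ 2 \<Rightarrow> ('a ^ 3) set"
  assumes data: "blokhuis_haemers_data D1 lab" and P: "P \<in> parallel_classes"
  shows "x \<in> lab P z \<longleftrightarrow> z = label_of lab P x"
proof -
  have bij: "bij_betw (lab P) UNIV P"
    using data P by (auto simp: blokhuis_haemers_data_def Let_def)
  have "\<exists>!z. x \<in> lab P z"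
    using parallel_class_ex1_line[OF P, of x] bij
    unfolding bij_betw_def by (metis injD rangeE rangeI)
  then show ?thesis
    unfolding label_of_def by (metis theI')
qed

lemma mem_bh_block_iff:
  fixes lab :: "('a::{field,finite} ^ 3) set set \<Rightarrow> 'a ^ 2 \<Rightarrow> ('a ^ 3) set"
  assumes data: "blokhuis_haemers_data D1 lab" and P: "P \<in> parallel_classes"
  shows "x \<in> bh_block D1 lab P b \<longleftrightarrow> incident D1 (label_of lab P x) b"
proof -
  have "points D1 = UNIV"
    using data by (simp add: blokhuis_haemers_data_def Let_def)
  then show ?thesis
    using label_of_unique[OF data P] by (auto simp: bh_block_def block_points_def)
qed

text \<open>If two classes shared a block, then it would be invariant under translations in the direction
  of the second class, which is impossible for the arc that defines it in the first one.\<close>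

lemma bh_block_determines_class:
  fixes lab :: "('a::{field,finite} ^ 3) set set \<Rightarrow> 'a ^ 2 \<Rightarrow> ('a ^ 3) set"
  assumes data: "blokhuis_haemers_data D1 lab"
    and P: "P \<in> parallel_classes" and P': "P' \<in> parallel_classes"
    and b: "b \<in> blocks D1" and ne: "block_points D1 b \<noteq> {}"
    and eq: "bh_block D1 lab P b = bh_block D1 lab P' b'"
  shows "P = P'"
proof (rule ccontr)
  assume "P \<noteq> P'"
  obtain U where U: "vec.subspace U" "vec.dim U = 1" and PU: "P = {(\<lambda>u. a + u) ` U | a. True}"
    using P by (auto simp: parallel_classes_def)
  obtain U' where U': "vec.subspace U'" "vec.dim U' = 1"
    and PU': "P' = {(\<lambda>u. a + u) ` U' | a. True}"
    using P' by (auto simp: parallel_classes_def)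
  have "\<not> U' \<subseteq> U"
    using vec.subspace_dim_equal[of U' U] U U' PU PU' \<open>P \<noteq> P'\<close> by auto
  then obtain v where v: "v \<in> U'" "v \<notin> U" by auto
  let ?S = "lab P ` block_points D1 b"
  have bij: "bij_betw (lab P) UNIV P" "bij_betw (lab P') UNIV P'"
    and arc: "maximal_arc CARD('a) (quotient_lines P) ?S"
    using data P P' b by (auto simp: blokhuis_haemers_data_def Let_def)
  have S: "?S \<subseteq> P"
    using bij by (auto simp: bij_betw_def)
  obtain z where z: "z \<in> block_points D1 b"
    using ne by auto
  have "lab P z \<in> P"
    using S z by auto
  then obtain a where "lab P z = (\<lambda>u. a + u) ` U"
    unfolding PU by auto
  then have "a \<in> lab P z"
    using mem_translate_self[OF U(1)] by simp
  then have a: "a \<in> \<Union>?S"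
    using z by auto
  then have "a \<in> \<Union>(lab P' ` block_points D1 b')"
    by (simp only: eq[unfolded bh_block_def])
  then obtain z' where z': "z' \<in> block_points D1 b'" "a \<in> lab P' z'"
    by auto
  have "lab P' z' \<in> P'"
    using bij by (auto simp: bij_betw_def)
  then have l': "lab P' z' = (\<lambda>u. a + u) ` U'"
    using translate_eq[OF U'(1)] z' unfolding PU' by blast
  have "a + t *s v \<in> \<Union>?S" for t
  proof -
    have "a + t *s v \<in> lab P' z'"
      unfolding l' using vec.subspace_scale[OF U'(1) v(1)] by blast
    then have "a + t *s v \<in> bh_block D1 lab P' b'"
      using z' by (auto simp: bh_block_def)
    then show ?thesis
      by (simp only: eq[symmetric]) (simp only: bh_block_def)
  qed
  then show False
    using maximal_arc_not_translation_invariant[OF U v(2) PU S arc a] by blast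
qed

lemma bh_block_inj:
  fixes lab :: "('a::{field,finite} ^ 3) set set \<Rightarrow> 'a ^ 2 \<Rightarrow> ('a ^ 3) set"
  assumes data: "blokhuis_haemers_data D1 lab"
    and ne: "\<forall>b\<in>blocks D1. block_points D1 b \<noteq> {}"
    and inj: "inj_on (block_points D1) (blocks D1)"
  shows "inj_on (\<lambda>(P, b). bh_block D1 lab P b) (parallel_classes \<times> blocks D1)"
proof (rule inj_onI, clarify)
  fix P b P' b'
  assume P: "P \<in> parallel_classes" and P': "P' \<in> parallel_classes"
    and b: "b \<in> blocks D1" and b': "b' \<in> blocks D1"
    and eq: "bh_block D1 lab P b = bh_block D1 lab P' b'"
  have PP': "P = P'"
    by (rule bh_block_determines_class[OF data P P' b bspec[OF ne b] eq])
  have "bij_betw (lab P) UNIV P"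
    using data P by (auto simp: blokhuis_haemers_data_def Let_def)
  have "z \<in> block_points D1 b \<longleftrightarrow> z \<in> block_points D1 b'" for z
  proof -
    obtain x where "x \<in> lab P z"
    proof -
      have "lab P z \<in> P"
        using \<open>bij_betw (lab P) UNIV P\<close> by (auto simp: bij_betw_def)
      then obtain a U where "vec.subspace U" "lab P z = (\<lambda>u. a + u) ` U"
        using P by (auto simp: parallel_classes_def)
      then show thesis
        using that mem_translate_self by blast
    qed
    then have z: "z = label_of lab P x"
      using label_of_unique[OF data P] by blast
    have "points D1 = UNIV"
      using data by (simp add: blokhuis_haemers_data_def Let_def)
    then show ?thesis
      using eq mem_bh_block_iff[OF data P, of x] unfolding z PP' block_points_def by blast
  qed
  with inj b b' have "b = b'"
    by (auto dest: inj_onD)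
  with PP' show "P = P' \<and> b = b'" by simp
qed

text \<open>The points \<open>x\<close> and \<open>y\<close> may coincide, so this covers both the weight of a row and the inner
  product of two rows.\<close>

lemma card_bh_blocks:
  fixes lab :: "('a::{field,finite} ^ 3) set set \<Rightarrow> 'a ^ 2 \<Rightarrow> ('a ^ 3) set"
  assumes data: "blokhuis_haemers_data D1 lab" and fin: "finite (blocks D1)"
    and ne: "\<forall>b\<in>blocks D1. block_points D1 b \<noteq> {}"
    and inj: "inj_on (block_points D1) (blocks D1)"
  shows "card {B \<in> blocks (blokhuis_haemers_design D1 lab). x \<in> B \<and> y \<in> B} =
    (\<Sum>P\<in>parallel_classes.
       card {b\<in>blocks D1. incident D1 (label_of lab P x) b \<and> incident D1 (label_of lab P y) b})"
proof -
  let ?T = "SIGMA P:parallel_classes. {b\<in>blocks D1. incident D1 (label_of lab P x) b \<and>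
    incident D1 (label_of lab P y) b}"
  have "{B \<in> blocks (blokhuis_haemers_design D1 lab). x \<in> B \<and> y \<in> B} =
      (\<lambda>(P, b). bh_block D1 lab P b) ` ?T"
    using mem_bh_block_iff[OF data, of _ x] mem_bh_block_iff[OF data, of _ y]
    by (fastforce simp: blokhuis_haemers_design_def simp flip: bh_block_def)
  moreover have "inj_on (\<lambda>(P, b). bh_block D1 lab P b) ?T"
    by (rule inj_on_subset[OF bh_block_inj[OF data ne inj]]) auto
  ultimately show ?thesis
    using fin by (simp add: card_image)
qed

theorem corollary3p5:
  fixes D1 :: "('a::{field,finite} ^ 2, 'b) incidence_structure"
    and lab :: "('a ^ 3) set set \<Rightarrow> 'a ^ 2 \<Rightarrow> ('a ^ 3) set"
    and D :: "('a ^ 3, ('a ^ 3) set) incidence_structure"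
    and q :: nat
  assumes "q = CARD('a)"
    and "\<exists>m. q = 2 ^ m"
    and "q \<ge> 4"
    and "blokhuis_haemers_data D1 lab"
    and "D = blokhuis_haemers_design D1 lab"
    and "quasi_symmetric D"
  shows "self_orthogonal (blocks D) (row_code D) \<and>
         (q \<ge> 8 \<longrightarrow> doubly_even (blocks D) (row_code D))"
proof -
  note data = assms(4)
  define k where "k = q * (q - 1) div 2"
  define lam where "lam = q * (q - 2) div 4"
  obtain m where m: "q = 2 ^ m"
    using assms(2) by blast
  have "m \<ge> 2"
  proof (rule ccontr)
    assume "\<not> m \<ge> 2"
    then have "m = 0 \<or> m = 1" by auto
    with m \<open>q \<ge> 4\<close> show False by auto
  qed
  then obtain j where j: "m = 2 + j"
    using le_Suc_ex by blast
  define n :: nat where "n = 2 ^ j"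
  have q: "q = 4 * n"
    by (simp add: m n_def j power_add)
  have n: "n \<ge> 1"
    by (simp add: n_def)
  \<comment> \<open>The factor 2 in both parameters makes the inner products even. For \<open>q \<ge> 8\<close> the number \<open>n\<close> is
    even as well and supplies a second factor 2 of \<open>k\<close>.\<close>
  have k_eq: "k = 2 * (n * (4 * n - 1))"
    by (simp add: k_def q)
  have lam_eq: "lam = 2 * (n * (2 * n - 1))"
  proof -
    have "4 * n - 2 = 2 * (2 * n - 1)" by simp
    then show ?thesis by (simp add: lam_def q)
  qed
  have "1 * 3 \<le> n * (4 * n - 1)"
    using n by (intro mult_le_mono) auto
  then have "1 < k"
    unfolding k_eq by linarith
  have "n * (2 * n - 1) < n * (4 * n - 1)"
    using n by (intro mult_strict_left_mono) auto
  then have "lam < k"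
    by (simp add: k_eq lam_eq)
  have D1: "symmetric_two_design D1 (q ^ 2) k lam" and UNIV: "points D1 = UNIV"
    using data by (auto simp: blokhuis_haemers_data_def Let_def k_def lam_def assms(1))
  then have D2: "two_design D1 (q ^ 2) k lam" and fin: "finite (blocks D1)"
    by (auto simp: symmetric_two_design_def two_design_def)
  have ne: "\<forall>b\<in>blocks D1. block_points D1 b \<noteq> {}"
    using D2 \<open>1 < k\<close> unfolding two_design_def by fastforce
  note inj = symmetric_two_design_inj_block_points[OF D1 \<open>1 < k\<close> \<open>lam < k\<close>]
  note count = card_bh_blocks[OF data fin ne inj, folded assms(5)]
  have rep: "card {b\<in>blocks D1. incident D1 z b} = k" for z
    using symmetric_two_design_replication[OF D1 \<open>1 < k\<close>] UNIV by simp
  have even_common: "even (card {B\<in>blocks D. x \<in> B \<and> y \<in> B})" for x y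
    unfolding count
  proof (rule dvd_sum)
    fix P :: "('a ^ 3) set set"
    show "even (card {b\<in>blocks D1. incident D1 (label_of lab P x) b \<and>
        incident D1 (label_of lab P y) b})"
    proof (cases "label_of lab P x = label_of lab P y")
      case True
      then show ?thesis using rep by (simp add: k_eq)
    next
      case False
      then have "card {b\<in>blocks D1. incident D1 (label_of lab P x) b \<and>
          incident D1 (label_of lab P y) b} = lam"
        using D2 UNIV unfolding two_design_def by blast
      then show ?thesis by (simp add: lam_eq)
    qed
  qed
  have finD: "finite (blocks D)"
    by (rule finite_subset[OF subset_UNIV]) simp
  have nonzero: "incidence_matrix D x B \<noteq> 0 \<longleftrightarrow> B \<in> blocks D \<and> x \<in> B" for x B
    by (simp add: incidence_matrix_def assms(5) blokhuis_haemers_design_def)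
  let ?G = "incidence_matrix D ` points D"
  have G: "?G \<subseteq> dual_code (blocks D) ?G"
  proof -
    have "(\<Sum>B\<in>blocks D. incidence_matrix D x B * incidence_matrix D y B) = 0" for x y
    proof -
      have "{B\<in>blocks D. incidence_matrix D x B \<noteq> 0 \<and> incidence_matrix D y B \<noteq> 0} =
          {B\<in>blocks D. x \<in> B \<and> y \<in> B}"
        unfolding nonzero by auto
      then show ?thesis
        using even_common by (simp only: inner_product_bit_eq_0_iff[OF finD])
    qed
    moreover have "incidence_matrix D x B = 0" if "B \<notin> blocks D" for x B
      using that by (simp add: incidence_matrix_def)
    ultimately show ?thesis
      unfolding dual_code_def by blast
  qed
  have "doubly_even (blocks D) (row_code D)" if "q \<ge> 8"
    unfolding row_code_def
  proof (rule doubly_even_span[OF finD G])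
    fix g assume "g \<in> ?G"
    then obtain x where g: "g = incidence_matrix D x" by auto
    have "j \<noteq> 0"
    proof
      assume "j = 0"
      with q \<open>q \<ge> 8\<close> show False by (simp add: n_def)
    qed
    then have "even n"
      by (simp add: n_def)
    then have "4 dvd k"
      unfolding k_eq using mult_dvd_mono[of 2 2 2 "n * (4 * n - 1)"] by simp
    have "{B\<in>blocks D. incidence_matrix D x B \<noteq> 0} = {B\<in>blocks D. x \<in> B \<and> x \<in> B}"
      unfolding nonzero by auto
    then have "hamming_weight (blocks D) g = (\<Sum>P\<in>(parallel_classes :: ('a ^ 3) set set set). k)"
      unfolding hamming_weight_def g using count[of x x] rep by simp
    with \<open>4 dvd k\<close> show "4 dvd hamming_weight (blocks D) g"
      by simp
  qed
  with self_orthogonal_span[OF G] show ?thesis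
    by (simp add: row_code_def)
qed

end
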